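(* For every integer $d\ge 1$, the $d$-dimensional infinite grid $G_{d;\infty}$ satisfies $\chi_{\mathrm{so}}(G_{d;\infty})=3$. As a consequence, $\varrho_{\mathrm{od}}(G_{d;\infty})\ge 1/3$.
   Context: $G_{d;\infty}=P_\infty\,\Box\cdots\Box\,P_\infty$ ($d$ factors, Cartesian product) is the graph with vertex set $\mathbb{Z}^d$ in which two vertices are adjacent iff they differ in exactly one coordinate, and there by exactly $1$. $N(v)$ is the open neighborhood of $v$. A strong odd coloring of a graph $G$ is a proper vertex coloring such that for every vertex $v$, each color used in $N(v)$ appears an odd number of times in $N(v)$; $\chi_{\mathrm{so}}(G)$ is the minimum number of colors in a strong odd coloring of $G$. An odd independent set is an independent set $S$ of vertices such that every $v\notin S$ has either $N(v)\cap S=\varnothing$ or $|N(v)\cap S|$ odd. The odd independence density is $\varrho_{\mathrm{od}}(G_{d;\infty}):=\sup_S\limsup_{H_n,\ n\to\infty}|S\cap V(H_n)|/n^d$, where $S$ ranges over all odd independent sets of $G_{d;\infty}$ and $H_n$ ranges over all $d$-dimensional subgrids $P_n\,\Box\cdots\Box\,P_n$ of $G_{d;\infty}$ (induced by products of $d$ intervals of $n$ consecutive integers). *)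

theory Defs
  imports "HOL-Library.FuncSet" "HOL-Library.Extended_Nat" "HOL-Library.Extended_Real"
begin

record 'a ugraph =
  verts :: "'a set"
  adj :: "'a \<Rightarrow> 'a \<Rightarrow> bool"

definition nbhd :: "'a ugraph \<Rightarrow> 'a \<Rightarrow> 'a set" where
  "nbhd G v = {u \<in> verts G. adj G v u}"

definition proper_coloring :: "'a ugraph \<Rightarrow> ('a \<Rightarrow> nat) \<Rightarrow> bool" where
  "proper_coloring G c \<longleftrightarrow> (\<forall>u\<in>verts G. \<forall>v\<in>verts G. adj G u v \<longrightarrow> c u \<noteq> c v)"

definition strong_odd_coloring :: "'a ugraph \<Rightarrow> ('a \<Rightarrow> nat) \<Rightarrow> bool" where
  "strong_odd_coloring G c \<longleftrightarrow> proper_coloring G c \<and>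
     (\<forall>v\<in>verts G. \<forall>k\<in>c ` nbhd G v. odd (card {u \<in> nbhd G v. c u = k}))"

text \<open>
  The infimum is taken in the extended naturals, so that it is a minimum if some finite
  number of colors suffices and \<open>\<infinity>\<close> otherwise.
\<close>

definition strong_odd_chromatic_number :: "'a ugraph \<Rightarrow> enat" where
  "strong_odd_chromatic_number G =
     Inf {enat k | k. \<exists>c. strong_odd_coloring G c \<and> c ` verts G \<subseteq> {..<k}}"

definition independent_set :: "'a ugraph \<Rightarrow> 'a set \<Rightarrow> bool" where
  "independent_set G S \<longleftrightarrow> S \<subseteq> verts G \<and> (\<forall>u\<in>S. \<forall>v\<in>S. \<not> adj G u v)"

definition odd_independent_set :: "'a ugraph \<Rightarrow> 'a set \<Rightarrow> bool" where
  "odd_independent_set G S \<longleftrightarrow> independent_set G S \<and>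
     (\<forall>v\<in>verts G - S. nbhd G v \<inter> S = {} \<or> odd (card (nbhd G v \<inter> S)))"

text \<open>
  Points of \<open>\<int>\<^sup>d\<close> are functions on \<open>{..<d}\<close>, made unique by being \<^const>\<open>undefined\<close> elsewhere.
\<close>

definition lattice_points :: "nat \<Rightarrow> (nat \<Rightarrow> int) set" where
  "lattice_points d = {..<d} \<rightarrow>\<^sub>E UNIV"

definition grid :: "nat \<Rightarrow> (nat \<Rightarrow> int) ugraph" where
  "grid d =
     \<lparr>verts = lattice_points d,
      adj = (\<lambda>x y. x \<in> lattice_points d \<and> y \<in> lattice_points d \<and>
        (\<exists>i<d. \<bar>x i - y i\<bar> = 1 \<and> (\<forall>j<d. j \<noteq> i \<longrightarrow> x j = y j)))\<rparr>"

text \<open>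
  The vertex set of the \<open>d\<close>-dimensional subgrid of side length \<open>n\<close> with least corner \<open>a\<close>.
\<close>

definition subgrid :: "nat \<Rightarrow> (nat \<Rightarrow> int) \<Rightarrow> nat \<Rightarrow> (nat \<Rightarrow> int) set" where
  "subgrid d a n = (\<Pi>\<^sub>E i\<in>{..<d}. {a i ..< a i + int n})"

text \<open>
  The upper limit over all subgrids \<open>H\<^sub>n\<close> with \<open>n \<rightarrow> \<infinity>\<close> is the upper limit, as \<open>n \<rightarrow> \<infinity>\<close>,
  of the supremum over the positions of a subgrid of side length \<open>n\<close>.
\<close>

definition odd_independence_density :: "nat \<Rightarrow> ereal" where
  "odd_independence_density d =
     (SUP S\<in>{S. odd_independent_set (grid d) S}.
        limsup (\<lambda>n. SUP a\<in>lattice_points d.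
          ereal (real (card (S \<inter> subgrid d a n)) / real n ^ d)))"

end

theory Submission
  imports Defs
begin

text \<open>
  Every vertex of \<open>\<int>\<^sup>d\<close> has \<open>2 * d\<close> neighbours, an even number, so all neighbours of a vertex
  cannot have the same color; hence two colors never suffice.

  For the upper bound, consider the height \<open>h x = x 0 + (\<Sum>i\<in>{1..<d}. x i mod 2)\<close>. Moving to a
  neighbour changes \<open>h\<close> by \<open>1\<close> or \<open>- 1\<close>. In direction \<open>0\<close>, one of the two neighbours is higher
  and the other one is lower; in any other direction, the two neighbours have the same height. So the
  numbers of higher and of lower neighbours are both odd, and \<open>h\<close> modulo \<open>3\<close> is a strong odd
  coloring (\<open>strong_odd_coloring_grid_color\<close>).

  For the density, the color classes are odd independent sets. The translation by \<open>1\<close> in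
  direction \<open>0\<close> permutes the three classes cyclically, so the numbers of points of the three
  colors in a cube of side length \<open>n\<close> are the numbers of points of color \<open>0\<close> in three translates
  of that cube. They add up to \<open>n ^ d\<close>, and hence one of these translates contains at least
  \<open>n ^ d / 3\<close> points of color \<open>0\<close>.
  This holds for every \<open>n\<close>, so the upper limit is at least \<open>1 / 3\<close>.
\<close>

section \<open>Neighborhoods in the grid\<close>

lemma verts_grid [simp]: "verts (grid d) = lattice_points d"
  by (simp add: grid_def)

lemma lattice_points_upd:
  "x \<in> lattice_points d \<Longrightarrow> i < d \<Longrightarrow> x(i := t) \<in> lattice_points d"
  by (auto simp: lattice_points_def PiE_iff extensional_def)

lemma nbhd_grid:
  assumes x: "x \<in> lattice_points d"
  shows "nbhd (grid d) x = (\<lambda>(i, s). x(i := x i + s)) ` ({..<d} \<times> {-1, 1})"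
proof (intro equalityI subsetI)
  fix y assume "y \<in> nbhd (grid d) x"
  then obtain i where y: "y \<in> lattice_points d" and i: "i < d" "\<bar>x i - y i\<bar> = 1"
      "\<forall>j<d. j \<noteq> i \<longrightarrow> x j = y j"
    by (auto simp: nbhd_def grid_def)
  have "y = x(i := x i + (y i - x i))"
  proof
    fix j show "y j = (x(i := x i + (y i - x i))) j"
      using x y i by (cases "j < d") (auto simp: lattice_points_def PiE_iff extensional_def)
  qed
  moreover have "y i - x i \<in> {-1, 1}" using i(2) by auto
  ultimately show "y \<in> (\<lambda>(i, s). x(i := x i + s)) ` ({..<d} \<times> {-1, 1})"
    using i(1) by (intro image_eqI[of _ _ "(i, y i - x i)"]) auto
next
  fix y assume "y \<in> (\<lambda>(i, s). x(i := x i + s)) ` ({..<d} \<times> {-1, 1})"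
  then obtain i s where y: "y = x(i := x i + s)" "i < d" "s = -1 \<or> s = 1" by auto
  then have "\<bar>x i - y i\<bar> = 1 \<and> (\<forall>j<d. j \<noteq> i \<longrightarrow> x j = y j)" by auto
  then show "y \<in> nbhd (grid d) x"
    using y x lattice_points_upd[OF x y(2)] by (auto simp: nbhd_def grid_def)
qed

lemma inj_on_nbhd_grid:
  fixes x :: "nat \<Rightarrow> int"
  shows "inj_on (\<lambda>(i, s). x(i := x i + s)) ({..<d} \<times> {-1, 1})"
proof (rule inj_onI, clarify)
  fix i s j t assume s: "s \<in> {-1, 1::int}" "t \<in> {-1, 1::int}"
    and eq: "x(i := x i + s) = x(j := x j + t)"
  have "i = j"
    using fun_cong[OF eq, of i] s by (auto split: if_splits)
  with fun_cong[OF eq, of i] show "i = j \<and> s = t" by simp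
qed

lemma card_nbhd_grid_filter:
  assumes "x \<in> lattice_points d"
  shows "card {u \<in> nbhd (grid d) x. P u} =
    card {(i, s). i < d \<and> s \<in> {-1, 1} \<and> P (x(i := x i + s))}"
proof -
  have "{u \<in> nbhd (grid d) x. P u} =
      (\<lambda>(i, s). x(i := x i + s)) ` {(i, s). i < d \<and> s \<in> {-1, 1} \<and> P (x(i := x i + s))}"
    unfolding nbhd_grid[OF assms] by auto
  moreover have "inj_on (\<lambda>(i, s). x(i := x i + s))
      {(i, s). i < d \<and> s \<in> {-1, 1} \<and> P (x(i := x i + s))}"
    by (rule inj_on_subset[OF inj_on_nbhd_grid[of x d]]) auto
  ultimately show ?thesis by (simp add: card_image)
qed

lemma card_nbhd_grid:
  assumes "x \<in> lattice_points d"
  shows "card (nbhd (grid d) x) = 2 * d"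
  unfolding nbhd_grid[OF assms]
  by (subst card_image[OF inj_on_nbhd_grid]) (simp add: card_cartesian_product)

section \<open>Two colors do not suffice\<close>

lemma strong_odd_coloring_grid_ge_3:
  assumes d: "d \<ge> 1" and c: "strong_odd_coloring (grid d) c"
    and k: "c ` lattice_points d \<subseteq> {..<k}"
  shows "k \<ge> 3"
proof (rule ccontr)
  assume "\<not> k \<ge> 3"
  then have c2: "c u < 2" if "u \<in> lattice_points d" for u
    using k that by fastforce
  \<comment> \<open>With two colors, all neighbours of the origin have the same color.\<close>
  define x :: "nat \<Rightarrow> int" where "x = (\<lambda>i\<in>{..<d}. 0)"
  have x: "x \<in> lattice_points d" by (simp add: x_def lattice_points_def)
  have col: "c u = 1 - c x" if "u \<in> nbhd (grid d) x" for u
  proof -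
    have u: "u \<in> lattice_points d" and adj: "adj (grid d) x u"
      using that by (simp_all add: nbhd_def)
    have "c x \<noteq> c u"
      using c x u adj by (auto simp: strong_odd_coloring_def proper_coloring_def)
    then show ?thesis using c2[OF x] c2[OF u] by linarith
  qed
  have "nbhd (grid d) x \<noteq> {}"
    using card_nbhd_grid[OF x] d by auto
  with col have "1 - c x \<in> c ` nbhd (grid d) x"
    by force
  with c x have "odd (card {u \<in> nbhd (grid d) x. c u = 1 - c x})"
    by (auto simp: strong_odd_coloring_def)
  moreover have "{u \<in> nbhd (grid d) x. c u = 1 - c x} = nbhd (grid d) x"
    using col by blast
  ultimately show False using card_nbhd_grid[OF x] by simp
qed

section \<open>A strong odd coloring with three colors\<close>

text \<open>
  The contribution of a coordinate with index \<open>i\<close> and value \<open>t\<close> to the height.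
\<close>

definition coord_height :: "nat \<Rightarrow> int \<Rightarrow> int" where
  "coord_height i t = (if i = 0 then t else t mod 2)"

text \<open>
  The height increases along coordinate \<open>0\<close>, and goes up and down with period \<open>2\<close> along every
  other coordinate.
\<close>

definition height :: "nat \<Rightarrow> (nat \<Rightarrow> int) \<Rightarrow> int" where
  "height d x = (\<Sum>i<d. coord_height i (x i))"

text \<open>
  The color is the height modulo \<open>3\<close>, as a natural number.
\<close>

definition grid_color :: "nat \<Rightarrow> (nat \<Rightarrow> int) \<Rightarrow> nat" where
  "grid_color d x = nat (height d x mod 3)"

lemma height_upd:
  assumes "i < d"
  shows "height d (x(i := t)) = height d x + coord_height i t - coord_height i (x i)"
proof -
  have "height d y = coord_height i (y i) + (\<Sum>j\<in>{..<d} - {i}. coord_height j (y j))" for y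
    unfolding height_def using assms by (subst sum.remove[of _ i]) auto
  from this[of x] this[of "x(i := t)"] show ?thesis by simp
qed

lemma height_step:
  assumes "i < d" "s \<in> {-1, 1}"
  shows "height d (x(i := x i + s)) =
    height d x + (if i = 0 then s else if even (x i) then 1 else -1)"
proof -
  have "coord_height i (x i + s) - coord_height i (x i) =
      (if i = 0 then s else if even (x i) then 1 else -1)"
    using assms(2) unfolding coord_height_def by auto presburger+
  then show ?thesis using height_upd[OF assms(1), of x "x i + s"] by simp
qed

lemma height_nbhd:
  assumes "x \<in> lattice_points d" "u \<in> nbhd (grid d) x"
  shows "height d u = height d x + 1 \<or> height d u = height d x - 1"
proof -
  obtain i s where "u = x(i := x i + s)" "i < d" "s \<in> {-1, 1}"
    using assms(2) unfolding nbhd_grid[OF assms(1)] by auto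
  then show ?thesis by (auto simp: height_step)
qed

lemma int_grid_color: "int (grid_color d x) = height d x mod 3"
  by (simp add: grid_color_def)

lemma grid_color_eq_iff:
  "grid_color d x = grid_color d y \<longleftrightarrow> height d x mod 3 = height d y mod 3"
  by (metis int_grid_color of_nat_eq_iff)

lemma grid_color_less: "grid_color d x < 3"
  unfolding grid_color_def by (simp add: nat_less_iff)

lemma odd_card_nbhd_height:
  assumes d: "d \<ge> 1" and x: "x \<in> lattice_points d" and e: "e = 1 \<or> e = -1"
  shows "odd (card {u \<in> nbhd (grid d) x. height d u = height d x + e})"
proof -
  \<comment> \<open>Besides direction \<open>0\<close>, which contributes one neighbour, these are the directions in which
    both neighbours have height \<open>height d x + e\<close>.\<close>
  define I where "I = {i \<in> {1..<d}. even (x i) \<longleftrightarrow> e = 1}"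
  have fin: "finite I" by (simp add: I_def)
  have step: "height d (x(i := x i + s)) = height d x + e \<longleftrightarrow>
      (if i = 0 then s = e else even (x i) \<longleftrightarrow> e = 1)" if "i < d" "s \<in> {-1, 1}" for i s
    using e unfolding height_step[OF that] by auto
  have "{(i, s). i < d \<and> s \<in> {-1, 1} \<and> height d (x(i := x i + s)) = height d x + e} =
      {(i, s). i < d \<and> s \<in> {-1, 1} \<and> (if i = 0 then s = e else even (x i) \<longleftrightarrow> e = 1)}"
    using step by blast
  also have "\<dots> = insert (0, e) (I \<times> {-1, 1})"
    using d e by (auto simp: I_def split: if_splits)
  finally have "{(i, s). i < d \<and> s \<in> {-1, 1} \<and> height d (x(i := x i + s)) = height d x + e} =
      insert (0, e) (I \<times> {-1, 1})" .
  moreover have "card (insert (0, e) (I \<times> {-1, 1})) = Suc (2 * card I)"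
    using fin by (subst card_insert_disjoint) (auto simp: I_def card_cartesian_product)
  ultimately show ?thesis
    by (simp only: card_nbhd_grid_filter[OF x]) simp
qed

lemma strong_odd_coloring_grid_color:
  assumes d: "d \<ge> 1"
  shows "strong_odd_coloring (grid d) (grid_color d)"
  unfolding strong_odd_coloring_def proper_coloring_def verts_grid
proof (intro conjI ballI impI)
  fix u v assume uv: "u \<in> lattice_points d" "v \<in> lattice_points d" "adj (grid d) u v"
  then have "v \<in> nbhd (grid d) u" by (simp add: nbhd_def)
  from height_nbhd[OF uv(1) this] show "grid_color d u \<noteq> grid_color d v"
    unfolding grid_color_eq_iff by presburger
next
  fix x k assume x: "x \<in> lattice_points d" and k: "k \<in> grid_color d ` nbhd (grid d) x"
  then obtain v where v: "v \<in> nbhd (grid d) x" "k = grid_color d v" by auto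
  define e where "e = height d v - height d x"
  have e: "e = 1 \<or> e = -1" using height_nbhd[OF x v(1)] by (auto simp: e_def)
  \<comment> \<open>Heights of neighbours differ by \<open>0\<close> or \<open>2\<close>, so they agree iff they agree modulo \<open>3\<close>.\<close>
  have "grid_color d u = k \<longleftrightarrow> height d u = height d x + e" if "u \<in> nbhd (grid d) x" for u
    using height_nbhd[OF x that] height_nbhd[OF x v(1)]
    by (auto simp: v(2) grid_color_eq_iff e_def mod_eq_dvd_iff)
  then have "{u \<in> nbhd (grid d) x. grid_color d u = k} =
      {u \<in> nbhd (grid d) x. height d u = height d x + e}" by blast
  with odd_card_nbhd_height[OF d x e]
  show "odd (card {u \<in> nbhd (grid d) x. grid_color d u = k})" by simp
qed

lemma strong_odd_chromatic_number_grid: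
  assumes d: "d \<ge> 1"
  shows "strong_odd_chromatic_number (grid d) = 3"
  unfolding strong_odd_chromatic_number_def
proof (rule antisym)
  have "grid_color d ` verts (grid d) \<subseteq> {..<3}"
    using grid_color_less by auto
  then show "Inf {enat k |k. \<exists>c. strong_odd_coloring (grid d) c \<and> c ` verts (grid d) \<subseteq> {..<k}} \<le> 3"
    using strong_odd_coloring_grid_color[OF d]
    by (intro Inf_lower) (auto simp: numeral_eq_enat)
  show "3 \<le> Inf {enat k |k. \<exists>c. strong_odd_coloring (grid d) c \<and> c ` verts (grid d) \<subseteq> {..<k}}"
    using strong_odd_coloring_grid_ge_3[OF d]
    by (intro Inf_greatest) (auto simp: numeral_eq_enat)
qed

section \<open>The density of a color class\<close>

lemma odd_independent_set_color_class:
  assumes "strong_odd_coloring G c"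
  shows "odd_independent_set G {x \<in> verts G. c x = k}"
proof -
  have "nbhd G v \<inter> {x \<in> verts G. c x = k} = {u \<in> nbhd G v. c u = k}" for v
    by (auto simp: nbhd_def)
  with assms show ?thesis
    unfolding odd_independent_set_def independent_set_def strong_odd_coloring_def
      proper_coloring_def by fastforce
qed

lemma finite_subgrid: "finite (subgrid d a n)"
  unfolding subgrid_def by (intro finite_PiE) auto

lemma card_subgrid: "card (subgrid d a n) = n ^ d"
  unfolding subgrid_def by (simp add: card_PiE)

lemma subgrid_subset_lattice_points: "subgrid d a n \<subseteq> lattice_points d"
  by (auto simp: subgrid_def lattice_points_def)

lemma subgrid_shift:
  assumes "x \<in> subgrid d a n" "i < d"
  shows "x(i := x i + t) \<in> subgrid d (a(i := a i + t)) n"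
  using assms by (auto simp: subgrid_def PiE_iff extensional_def)

lemma card_grid_color_shift:
  assumes d: "d \<ge> 1" and k: "k < 3"
  shows "card {x \<in> subgrid d (a(0 := a 0 - int k)) n. grid_color d x = 0} =
    card {x \<in> subgrid d a n. grid_color d x = k}"
proof (rule bij_betw_same_card[of "\<lambda>x. x(0 := x 0 + int k)"],
    rule bij_betw_byWitness[where f' = "\<lambda>x. x(0 := x 0 - int k)"])
  have h: "height d (x(0 := t)) = height d x + t - x 0" for x t
    using d by (subst height_upd) (auto simp: coord_height_def)
  have up: "grid_color d (x(0 := x 0 + int k)) = k" if "grid_color d x = 0" for x
  proof -
    have "int (grid_color d (x(0 := x 0 + int k))) = (height d x mod 3 + int k) mod 3"
      by (simp add: int_grid_color h mod_add_left_eq)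
    then have "int (grid_color d (x(0 := x 0 + int k))) = int k"
      using that int_grid_color[of d x] k by simp
    then show ?thesis by (simp only: of_nat_eq_iff)
  qed
  have down: "grid_color d (x(0 := x 0 - int k)) = 0" if "grid_color d x = k" for x
  proof -
    have "int (grid_color d (x(0 := x 0 - int k))) = (height d x mod 3 - int k) mod 3"
      by (simp add: int_grid_color h mod_diff_left_eq)
    then have "int (grid_color d (x(0 := x 0 - int k))) = int 0"
      using that int_grid_color[of d x] by simp
    then show ?thesis by (simp only: of_nat_eq_iff)
  qed
  show "(\<lambda>x. x(0 := x 0 + int k)) `
      {x \<in> subgrid d (a(0 := a 0 - int k)) n. grid_color d x = 0}
      \<subseteq> {x \<in> subgrid d a n. grid_color d x = k}"
    using up d subgrid_shift[of _ d "a(0 := a 0 - int k)" n 0 "int k"] by auto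
  show "(\<lambda>x. x(0 := x 0 - int k)) ` {x \<in> subgrid d a n. grid_color d x = k}
      \<subseteq> {x \<in> subgrid d (a(0 := a 0 - int k)) n. grid_color d x = 0}"
    using down d subgrid_shift[of _ d a n 0 "- int k"] by auto
qed auto

lemma dense_subgrid_exists:
  assumes d: "d \<ge> 1"
  shows "\<exists>a\<in>lattice_points d. 3 * card {x \<in> subgrid d a n. grid_color d x = 0} \<ge> n ^ d"
proof -
  define a :: "nat \<Rightarrow> int" where "a = (\<lambda>i\<in>{..<d}. 0)"
  have a: "a \<in> lattice_points d" by (simp add: a_def lattice_points_def)
  define N where "N k = card {x \<in> subgrid d a n. grid_color d x = k}" for k
  have "subgrid d a n = (\<Union>k<3. {x \<in> subgrid d a n. grid_color d x = k})"
    using grid_color_less by auto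
  then have "n ^ d = card (\<Union>k<3. {x \<in> subgrid d a n. grid_color d x = k})"
    using card_subgrid[of d a n] by simp
  also have "\<dots> = (\<Sum>k<3. N k)"
    unfolding N_def by (intro card_UN_disjoint) (auto simp: finite_subgrid)
  finally have sum: "n ^ d = (\<Sum>k<3. N k)" .
  have "\<exists>k<3. n ^ d \<le> 3 * N k"
  proof (rule ccontr)
    assume "\<not> (\<exists>k<3. n ^ d \<le> 3 * N k)"
    then have "3 * N 0 < n ^ d" "3 * N 1 < n ^ d" "3 * N 2 < n ^ d"
      by (simp_all add: not_le)
    moreover have "n ^ d = N 0 + N 1 + N 2"
      using sum by (simp add: lessThan_Suc numeral_3_eq_3 numeral_2_eq_2)
    ultimately show False by linarith
  qed
  then obtain k where k: "k < 3" "n ^ d \<le> 3 * N k" by blast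
  have "a(0 := a 0 - int k) \<in> lattice_points d"
    using a d by (intro lattice_points_upd) auto
  with k show ?thesis
    using card_grid_color_shift[OF d k(1), of a n]
    by (intro bexI[of _ "a(0 := a 0 - int k)"]) (simp_all add: N_def)
qed

lemma odd_independence_density_grid:
  assumes d: "d \<ge> 1"
  shows "ereal (1 / 3) \<le> odd_independence_density d"
proof -
  define S where "S = {x \<in> lattice_points d. grid_color d x = 0}"
  have S: "odd_independent_set (grid d) S"
    using odd_independent_set_color_class[OF strong_odd_coloring_grid_color[OF d], of 0]
    by (simp add: S_def)
  have "ereal (1 / 3) \<le> (SUP a\<in>lattice_points d.
      ereal (real (card (S \<inter> subgrid d a n)) / real n ^ d))" if n: "n \<ge> 1" for n
  proof -
    obtain a where a: "a \<in> lattice_points d"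
        "3 * card {x \<in> subgrid d a n. grid_color d x = 0} \<ge> n ^ d"
      using dense_subgrid_exists[OF d] by blast
    have "S \<inter> subgrid d a n = {x \<in> subgrid d a n. grid_color d x = 0}"
      using subgrid_subset_lattice_points by (auto simp: S_def)
    with a(2) have "n ^ d \<le> 3 * card (S \<inter> subgrid d a n)" by simp
    then have "real (n ^ d) \<le> real (3 * card (S \<inter> subgrid d a n))"
      by (simp only: of_nat_le_iff)
    with n have "ereal (1 / 3) \<le> ereal (real (card (S \<inter> subgrid d a n)) / real n ^ d)"
      by (simp add: field_simps)
    then show ?thesis by (rule SUP_upper2[OF a(1)])
  qed
  then have "ereal (1 / 3) \<le> limsup (\<lambda>n. SUP a\<in>lattice_points d.
      ereal (real (card (S \<inter> subgrid d a n)) / real n ^ d))"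
    by (intro le_Limsup) (auto intro: eventually_sequentiallyI[of 1])
  then show ?thesis
    unfolding odd_independence_density_def using S by (intro SUP_upper2[of S]) auto
qed

theorem theorem14:
  fixes d :: nat
  assumes "d \<ge> 1"
  shows "strong_odd_chromatic_number (grid d) = 3 \<and> odd_independence_density d \<ge> ereal (1 / 3)"
  using strong_odd_chromatic_number_grid[OF assms] odd_independence_density_grid[OF assms] by simp

end
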